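(* There exists a constant $c_1\approx 2.29$, independent of the initial (even) configuration of the Propp machine on $\mathbb{Z}$, the time $t$, or the location $x$, so that $$|f(x,t)-E(x,t)|\le c_1 .$$
   Context: Propp machine on $\mathbb{Z}$: at each integer time $t\ge 0$, each vertex $x\in\mathbb{Z}$ holds a number $f(x,t)$ (a non-negative integer) of chips and an arrow $\mathrm{ARR}(x,t)\in\{-1,+1\}$ ($+1$ = pointing right, $-1$ = pointing left). In each time step every vertex sends out all its chips one after another to its two neighbors, each chip going in the direction of the arrow, which is flipped after each chip. Thus the initial configuration (the values $f(x,0)$ and $\mathrm{ARR}(x,0)$, $x\in\mathbb{Z}$) determines all later configurations by $$f(x,t+1)=\tfrac12 f(x-1,t)+\tfrac12 f(x+1,t)+\tfrac12\mathrm{ARR}(x-1,t)\,(f(x-1,t)\bmod 2)-\tfrac12\mathrm{ARR}(x+1,t)\,(f(x+1,t)\bmod 2),$$ $$\mathrm{ARR}(x,t+1)=(-1)^{f(x,t)}\,\mathrm{ARR}(x,t).$$ A configuration is called even if no chip is at an odd position (the arrows are unrestricted). $E(x,t)$ denotes the expected number of chips at $x$ after all chips of the same initial configuration perform simple random walks on $\mathbb{Z}$ for $t$ steps; equivalently, the number of chips at $x$ after $t$ steps of the linear machine, in which each vertex sends exactly half of its (possibly non-integral) number of chips to each neighbor in every step. *)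

theory Defs
  imports "HOL-Probability.Probability"
begin

section \<open>The Propp machine on the integers\<close>

text \<open>
  A configuration consists of the number of chips and the arrow of every vertex; the arrow
  \<open>1\<close> points right and \<open>-1\<close> points left. Infinitely many vertices may hold chips.
\<close>

type_synonym configuration = "(int \<Rightarrow> nat) \<times> (int \<Rightarrow> int)"

text \<open>
  The chips \<open>i = 0, 1, \<dots>, n - 1\<close> of a vertex leave one after another. As the arrow \<open>a\<close> is flipped
  after each of them, chip \<open>i\<close> leaves in direction \<open>a * (-1) ^ i\<close>. The number of chips
  leaving in direction \<open>d\<close> is:
\<close>

definition sent :: "nat \<Rightarrow> int \<Rightarrow> int \<Rightarrow> nat" where
  "sent n a d = card {i. i < n \<and> a * (-1) ^ i = d}"

definition propp_step :: "configuration \<Rightarrow> configuration" where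
  "propp_step = (\<lambda>(f, arr).
     (\<lambda>x. sent (f (x - 1)) (arr (x - 1)) 1 + sent (f (x + 1)) (arr (x + 1)) (-1),
      \<lambda>x. (-1) ^ f x * arr x))"

definition propp :: "configuration \<Rightarrow> nat \<Rightarrow> configuration" where
  "propp c t = (propp_step ^^ t) c"

definition propp_chips :: "configuration \<Rightarrow> int \<Rightarrow> nat \<Rightarrow> nat" where
  "propp_chips c x t = fst (propp c t) x"

definition propp_arrow :: "configuration \<Rightarrow> int \<Rightarrow> nat \<Rightarrow> int" where
  "propp_arrow c x t = snd (propp c t) x"

definition valid_config :: "configuration \<Rightarrow> bool" where
  "valid_config c \<longleftrightarrow> (\<forall>x. snd c x \<in> {-1, 1})"

definition even_config :: "configuration \<Rightarrow> bool" where
  "even_config c \<longleftrightarrow> (\<forall>x. odd x \<longrightarrow> fst c x = 0)"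

lemma propp_chips_0 [simp]: "propp_chips c x 0 = fst c x"
  by (simp add: propp_chips_def propp_def)

lemma propp_arrow_0 [simp]: "propp_arrow c x 0 = snd c x"
  by (simp add: propp_arrow_def propp_def)

lemma propp_arrow_Suc: "propp_arrow c x (Suc t) = (-1) ^ propp_chips c x t * propp_arrow c x t"
  by (simp add: propp_arrow_def propp_chips_def propp_def propp_step_def case_prod_beta)

lemma propp_arrow_valid:
  assumes "valid_config c"
  shows "propp_arrow c x t \<in> {-1, 1}"
proof (induction t)
  case 0
  then show ?case using assms by (simp add: valid_config_def)
next
  case (Suc t)
  then show ?case by (cases "even (propp_chips c x t)") (auto simp: propp_arrow_Suc)
qed

lemma sent_Suc: "sent (Suc n) a d = sent n a d + (if a * (-1) ^ n = d then 1 else 0)"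
proof -
  have "{i. i < Suc n \<and> a * (-1) ^ i = d} =
      (if a * (-1) ^ n = d then insert n {i. i < n \<and> a * (-1) ^ i = d}
       else {i. i < n \<and> a * (-1) ^ i = d})"
    by (auto simp: less_Suc_eq)
  then show ?thesis by (simp add: sent_def)
qed

lemma sent_formula:
  assumes "a \<in> {-1, 1}" and "d \<in> {-1, 1}"
  shows "real (sent n a d) = real n / 2 + of_int (d * a) * real (n mod 2) / 2"
proof (induction n)
  case 0
  then show ?case by (simp add: sent_def)
next
  case (Suc n)
  then show ?case using assms
    by (cases "even n") (auto simp: sent_Suc mod2_eq_if field_simps)
qed

lemma propp_chips_Suc:
  assumes "valid_config c"
  shows "real (propp_chips c x (Suc t)) =
      1/2 * real (propp_chips c (x - 1) t) + 1/2 * real (propp_chips c (x + 1) t)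
      + 1/2 * of_int (propp_arrow c (x - 1) t) * real (propp_chips c (x - 1) t mod 2)
      - 1/2 * of_int (propp_arrow c (x + 1) t) * real (propp_chips c (x + 1) t mod 2)"
proof -
  have "propp_chips c x (Suc t) =
      sent (propp_chips c (x - 1) t) (propp_arrow c (x - 1) t) 1 +
      sent (propp_chips c (x + 1) t) (propp_arrow c (x + 1) t) (-1)"
    by (simp add: propp_arrow_def propp_chips_def propp_def propp_step_def case_prod_beta)
  then show ?thesis
    using propp_arrow_valid[OF assms]
    by (simp add: sent_formula)
qed

section \<open>Simple random walk\<close>

primrec walk :: "nat \<Rightarrow> int \<Rightarrow> int pmf" where
  "walk 0 y = return_pmf y"
| "walk (Suc t) y = bind_pmf (walk t y) (\<lambda>z. pmf_of_set {z - 1, z + 1})"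

text \<open>
  By linearity of expectation, the expected number of chips at \<open>x\<close> is the sum, over all chips, of
  the probability that this chip is at \<open>x\<close>. For given \<open>x\<close> and \<open>t\<close> only finitely many terms are
  non-zero.
\<close>

definition expected_chips :: "configuration \<Rightarrow> int \<Rightarrow> nat \<Rightarrow> real" where
  "expected_chips c x t = (\<Sum>\<^sub>\<infinity>y. real (fst c y) * pmf (walk t y) x)"

lemma pmf_walk_Suc: "pmf (walk (Suc t) y) x = (pmf (walk t y) (x - 1) + pmf (walk t y) (x + 1)) / 2"
proof -
  have eq: "pmf (pmf_of_set {z - 1, z + 1}) x
      = (indicator {x + 1} z + indicator {x - 1} z) / (2 :: real)" for z :: int
    by (auto simp: indicator_def)
  have "pmf (walk (Suc t) y) x
      = measure_pmf.expectation (walk t y) (\<lambda>z. (indicator {x + 1} z + indicator {x - 1} z) / 2)"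
    by (simp add: pmf_bind eq)
  also have "\<dots> = (pmf (walk t y) (x - 1) + pmf (walk t y) (x + 1)) / 2"
    by (subst integral_divide_zero, subst Bochner_Integration.integral_add)
       (auto simp: measure_pmf_single less_top[symmetric] intro!: integrable_real_indicator)
  finally show ?thesis .
qed

lemma pmf_walk_eq_0: "y \<notin> {x - int t..x + int t} \<Longrightarrow> pmf (walk t y) x = 0"
proof (induction t arbitrary: x)
  case 0
  then show ?case by simp
next
  case (Suc t)
  have "y \<notin> {x - 1 - int t..x - 1 + int t}" "y \<notin> {x + 1 - int t..x + 1 + int t}"
    using Suc.prems by auto
  then show ?case using Suc.IH by (simp add: pmf_walk_Suc del: walk.simps)
qed

lemma expected_chips_summable: "(\<lambda>y. real (fst c y) * pmf (walk t y) x) summable_on UNIV"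
  by (rule finite_nonzero_values_imp_summable_on, rule finite_subset[of _ "{x - int t..x + int t}"])
     (use pmf_walk_eq_0 in force)+

lemma expected_chips_0: "expected_chips c x 0 = real (fst c x)"
proof -
  have "expected_chips c x 0 = (\<Sum>\<^sub>\<infinity>y\<in>{x}. real (fst c y) * pmf (walk 0 y) x)"
    unfolding expected_chips_def by (rule infsum_cong_neutral) auto
  then show ?thesis by simp
qed

text \<open>Equivalently, \<^const>\<open>expected_chips\<close> is the linear machine.\<close>

lemma expected_chips_Suc:
  "expected_chips c x (Suc t) = (expected_chips c (x - 1) t + expected_chips c (x + 1) t) / 2"
proof -
  have "expected_chips c x (Suc t) = (\<Sum>\<^sub>\<infinity>y. (real (fst c y) * pmf (walk t y) (x - 1)
      + real (fst c y) * pmf (walk t y) (x + 1)) * (1/2))"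
    unfolding expected_chips_def by (simp only: pmf_walk_Suc) (simp add: field_simps)
  also have "\<dots> = (expected_chips c (x - 1) t + expected_chips c (x + 1) t) * (1/2)"
    unfolding expected_chips_def
    by (subst infsum_cmult_left', subst infsum_add) (auto intro: expected_chips_summable)
  finally show ?thesis by simp
qed

end

theory Submission
  imports Defs
begin

text \<open>
  Why the discrepancy is bounded. In each step the Propp machine differs from the linear machine
  only at the vertices with an odd number of chips, each of which sends half a chip too many in
  the direction of its arrow and half a chip too few in the other one. The linear machine then
  propagates every such imbalance, so that the discrepancy at \<open>x\<close> and time \<open>t\<close> is a sum over
  vertices \<open>y\<close> and times \<open>s\<close> of imbalance times influence (\<open>discrepancy_eq_sum_influence\<close>).
  As the arrow of \<open>y\<close> changes between two steps exactly when the imbalance is nonzero, the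
  imbalances of one vertex have alternating signs: they are half the changes of the arrow, a
  sequence with values \<open>1\<close> and \<open>-1\<close>. Summation by parts therefore bounds the contribution of \<open>y\<close>
  by the largest influence, as soon as the influence is unimodal in time
  (\<open>alternating_sum_le_twice_peak\<close>).

  If \<open>u\<close> steps are left, including the one that creates the imbalance, then the influence over a
  distance \<open>d > 0\<close> equals, by reflection, the probability
  \<open>d / u * (u choose (u - d) / 2) / 2 ^ u\<close> that simple random walk hits \<open>d\<close> for the first time at
  time \<open>u\<close>. For an even configuration only the times \<open>u = d + 2 * j\<close> matter. The
  quotient of the values for \<open>j + 1\<close> and \<open>j\<close> shows unimodality with the maximum at
  \<open>j = (d - 1) * (d - 2) div 6\<close>, that is, near \<open>u = d\<^sup>2 / 3\<close>. Adding up these maxima over all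
  vertices \<open>x + d\<close> and \<open>x - d\<close> gives \<open>discrepancy_le_sum_peaks\<close>: the discrepancy is at most twice
  the sum of all \<open>peak_passage d\<close>.

  Twice the series is about \<open>2.2942\<close>. Its first 24 terms are evaluated exactly. The others are compared
  with \<open>0.933 / d\<^sup>2\<close>, where a Gaussian estimate of the binomial coefficients yields a
  constant close to the limit \<open>3 * sqrt (6 / pi) * exp (-3/2)\<close>, about \<open>0.925\<close>, of
  \<open>d\<^sup>2 * peak_passage d\<close>. Twice the two parts add up to less than \<open>2.2949\<close>.
\<close>

section \<open>Alternating sums with unimodal weights\<close>

text \<open>
  The increments of a sequence with values in \<open>[-1, 1]\<close> telescope against the weights. After \<open>t\<close>
  steps the sum, corrected by the boundary term \<open>a t * W t\<close>, is bounded by the total variation of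
  \<open>W\<close> passed so far plus \<open>W 0\<close>, and a nonnegative unimodal \<open>W\<close> climbs to \<open>W m\<close> and descends from
  it only once.
\<close>

lemma alternating_sum_le_twice_peak:
  fixes a W :: "nat \<Rightarrow> real"
  assumes a: "\<And>n. \<bar>a n\<bar> \<le> 1"
    and up: "\<And>n. n < m \<Longrightarrow> W n \<le> W (Suc n)"
    and down: "\<And>n. m \<le> n \<Longrightarrow> W (Suc n) \<le> W n"
    and nonneg: "\<And>n. 0 \<le> W n"
  shows "\<bar>\<Sum>n<t. (a n - a (Suc n)) * W n\<bar> \<le> 2 * W m"
proof -
  define S where "S t = (\<Sum>n<t. (a n - a (Suc n)) * W n)" for t
  have step: "S (Suc t) + a (Suc t) * W (Suc t) = (S t + a t * W t) + a (Suc t) * (W (Suc t) - W t)" for t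
    by (simp add: S_def algebra_simps)
  have aw: "\<bar>a n * w\<bar> \<le> \<bar>w\<bar>" for n w
    using mult_right_mono[OF a[of n], of "\<bar>w\<bar>"] by (simp add: abs_mult)
  \<comment> \<open>On the way up the variation so far is \<open>W t - W 0\<close>, after the peak it is
    \<open>2 * W m - W 0 - W t\<close>.\<close>
  have inv: "\<bar>S t + a t * W t\<bar> \<le> (if t \<le> m then W t else 2 * W m - W t)" for t
  proof (induction t)
    case 0
    then show ?case using aw[of 0 "W 0"] nonneg[of 0] by (simp add: S_def)
  next
    case (Suc t)
    have "\<bar>S (Suc t) + a (Suc t) * W (Suc t)\<bar> \<le> \<bar>S t + a t * W t\<bar> + \<bar>W (Suc t) - W t\<bar>"
      unfolding step using aw[of "Suc t" "W (Suc t) - W t"] by linarith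
    moreover have "\<bar>S t + a t * W t\<bar> \<le> W t" if "t \<le> m" using Suc that by simp
    moreover have "\<bar>S t + a t * W t\<bar> \<le> 2 * W m - W t" if "m \<le> t" using Suc that by (cases "t = m") auto
    moreover have "Suc t \<le> m \<or> m \<le> t" by linarith
    ultimately show ?case using up[of t] down[of t] by (cases "Suc t \<le> m") fastforce+
  qed
  have le_peak: "W t \<le> W m" if "t \<le> m"
    using that by (induction rule: inc_induct) (use up in \<open>blast intro: order_trans\<close>)+
  have "\<bar>S t\<bar> \<le> \<bar>S t + a t * W t\<bar> + W t"
    using aw[of t "W t"] nonneg[of t] by linarith
  then have "\<bar>S t\<bar> \<le> 2 * W m"
    using inv[of t] le_peak by (cases "t \<le> m") force+
  then show ?thesis by (simp add: S_def)
qed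

section \<open>The influence of an imbalance\<close>

text \<open>
  \<open>influence n z\<close> is the effect, after \<open>n\<close> further steps of the linear machine and at displacement
  \<open>z\<close>, of moving half a chip from the left to the right neighbour of a vertex.
\<close>

primrec influence :: "nat \<Rightarrow> int \<Rightarrow> real" where
  "influence 0 z = (if z = 1 then 1/2 else if z = -1 then -1/2 else 0)"
| "influence (Suc n) z = (influence n (z - 1) + influence n (z + 1)) / 2"

lemma influence_minus: "influence n (- z) = - influence n z"
proof (induction n arbitrary: z)
  case (Suc n)
  have "- z - 1 = - (z + 1)" "- z + 1 = - (z - 1)" by auto
  then show ?case by (simp only: influence.simps Suc) (simp add: field_simps)
qed auto

lemma influence_eq_0: "\<bar>z\<bar> > int n + 1 \<Longrightarrow> influence n z = 0"
  by (induction n arbitrary: z) auto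

text \<open>
  A walk of \<open>n + 1\<close> steps with \<open>k\<close> steps to the right has displacement \<open>2 * k - n - 1\<close>. There are
  \<open>n choose (k - 1)\<close> such walks that begin with a step to the right and \<open>n choose k\<close> others.
\<close>

lemma influence_binomial:
  "influence n (2 * int k - int n - 1)
    = ((if k = 0 then 0 else real (n choose (k - 1))) - real (n choose k)) / 2 ^ Suc n"
proof (induction n arbitrary: k)
  case 0
  consider "k = 0" | "k = 1" | "k \<ge> 2" by linarith
  then show ?case by cases (auto simp: binomial_eq_0)
next
  case (Suc n)
  have z: "2 * int k - int (Suc n) - 1 + 1 = 2 * int k - int n - 1" by simp
  show ?case
  proof (cases k)
    case 0
    have "influence n (- int n - 3) = 0" by (rule influence_eq_0) simp
    moreover have "2 * int 0 - int (Suc n) - 1 - 1 = - int n - 3" by simp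
    ultimately show ?thesis using Suc[of 0] by (simp only: 0 influence.simps z[unfolded 0]) simp
  next
    case k: (Suc k')
    have "2 * int k - int (Suc n) - 1 - 1 = 2 * int k' - int n - 1" using k by simp
    then have "influence (Suc n) (2 * int k - int (Suc n) - 1)
        = ((if k' = 0 then 0 else real (n choose (k' - 1))) - real (n choose k')
          + (real (n choose k') - real (n choose k))) / 2 ^ Suc n / 2"
      unfolding influence.simps z add_divide_distrib using Suc[of k] Suc[of k'] k by simp
    moreover have "real (Suc n choose (k - 1))
        = (if k' = 0 then 0 else real (n choose (k' - 1))) + real (n choose k')"
      using k by (cases k') auto
    moreover have "real (Suc n choose k) = real (n choose k') + real (n choose k)"
      by (simp add: k)
    moreover have "k \<noteq> 0" using k by simp
    ultimately show ?thesis by (simp only: if_False) simp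
  qed
qed

section \<open>First passage probabilities\<close>

text \<open>
  The probability that simple random walk has displacement \<open>y\<close> after \<open>y + 2 * j\<close> steps, \<open>j\<close> of
  which go the other way. Using \<open>j\<close> instead of the number of steps builds in the parity condition.
\<close>

definition walk_prob :: "nat \<Rightarrow> nat \<Rightarrow> real" where
  "walk_prob y j = real ((y + 2 * j) choose j) / 2 ^ (y + 2 * j)"

text \<open>
  By the ballot theorem, this is the probability that simple random walk first hits \<open>y > 0\<close> after
  exactly \<open>y + 2 * j\<close> steps.
\<close>

definition first_passage :: "nat \<Rightarrow> nat \<Rightarrow> real" where
  "first_passage y j = real y / real (y + 2 * j) * walk_prob y j"

text \<open>
  For \<open>y > 0\<close> this is the largest first passage probability, as \<open>first_passage_unimodal\<close> shows. For
  \<open>y = 0\<close> it is \<open>0\<close>, which is the right value for the influence of a vertex on itself.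
\<close>

definition peak_passage :: "nat \<Rightarrow> real" where
  "peak_passage y = first_passage y ((y - 1) * (y - 2) div 6)"

lemma first_passage_nonneg: "first_passage y j \<ge> 0"
  by (simp add: first_passage_def walk_prob_def)

lemma peak_passage_nonneg: "peak_passage y \<ge> 0"
  by (simp add: peak_passage_def first_passage_nonneg)

lemma peak_passage_0 [simp]: "peak_passage 0 = 0"
  by (simp add: peak_passage_def first_passage_def)

lemma influence_eq_first_passage:
  assumes "y > 0"
  shows "influence (y + 2 * j - 1) (int y) = first_passage y j"
proof -
  obtain w where y: "y = Suc w" using assms gr0_implies_Suc by blast
  define n where "n = w + 2 * j"
  define k where "k = w + j"
  have eq: "influence n (2 * int (Suc k) - int n - 1) = (real (n choose k) - real (n choose Suc k)) / 2 ^ Suc n"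
    by (simp only: influence_binomial) simp
  have "Suc n * (n choose k) = (Suc n choose Suc k) * Suc k"
    by (rule Suc_times_binomial_eq)
  then have 1: "real (Suc n) * real (n choose k) = real (Suc n choose Suc k) * real (Suc k)"
    by (metis of_nat_mult)
  have "(Suc n - Suc k) * (Suc n choose Suc k) = Suc n * (n choose Suc k)"
    using binomial_absorb_comp[of "Suc n" "Suc k"] by simp
  moreover have "Suc n - Suc k = j" by (simp add: n_def k_def)
  ultimately have 2: "real (Suc n) * real (n choose Suc k) = real j * real (Suc n choose Suc k)"
    by (metis of_nat_mult)
  have "real (Suc n) * (real (n choose k) - real (n choose Suc k)) = real (Suc n choose Suc k) * real y"
    unfolding right_diff_distrib 1 2 by (simp add: k_def y algebra_simps)
  then have 3: "real (n choose k) - real (n choose Suc k) = real y / real (Suc n) * real (Suc n choose Suc k)"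
    by (simp add: field_simps)
  have "Suc n - j = Suc k" by (simp add: n_def k_def)
  then have 4: "Suc n choose Suc k = (Suc n choose j)"
    using binomial_symmetric[of j "Suc n"]
    by (simp add: n_def del: binomial_Suc_Suc)
  have "y + 2 * j - 1 = n" "int y = 2 * int (Suc k) - int n - 1" "y + 2 * j = Suc n"
    by (auto simp: y n_def k_def)
  then show ?thesis using eq 3 4
    by (simp add: first_passage_def walk_prob_def del: binomial_Suc_Suc)
qed

lemma first_passage_Suc:
  assumes "y > 0"
  shows "first_passage y (Suc j) * real (4 * (j + 1) * (y + j + 1))
    = first_passage y j * real ((y + 2 * j) * (y + 2 * j + 1))"
proof -
  define u where "u = y + 2 * j"
  have "Suc (Suc u) * (Suc u choose j) = (Suc (Suc u) choose Suc j) * Suc j"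
    by (rule Suc_times_binomial_eq)
  then have 1: "real (Suc (Suc u) choose Suc j) * real (j + 1) = real (u + 2) * real (Suc u choose j)"
    by (metis Suc_eq_plus1 add_2_eq_Suc' of_nat_mult)
  have "(Suc u - j) * (Suc u choose j) = Suc u * (u choose j)"
    using binomial_absorb_comp[of "Suc u" j] by simp
  moreover have "Suc u - j = y + j + 1" by (simp add: u_def)
  ultimately have 2: "real (Suc u choose j) * real (y + j + 1) = real (u + 1) * real (u choose j)"
    by (metis Suc_eq_plus1 mult.commute of_nat_mult)
  have u2: "y + 2 * Suc j = Suc (Suc u)" by (simp add: u_def)
  have pos: "real u > 0" using assms by (simp add: u_def)
  have alg: "p / q * (b / (2 * (2 * e))) * (4 * r * s) = p / q / e * (b * r * s)" for p q b e r s :: real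
    by simp
  have "first_passage y (Suc j) * real (4 * (j + 1) * (y + j + 1))
      = real y / real (u + 2) / 2 ^ u * (real (Suc (Suc u) choose Suc j) * real (j + 1) * real (y + j + 1))"
    unfolding first_passage_def walk_prob_def u2 of_nat_mult power_Suc of_nat_numeral add_2_eq_Suc' by (rule alg)
  also have "\<dots> = real y / 2 ^ u * (real (Suc u choose j) * real (y + j + 1))"
    unfolding 1 by (simp del: binomial_Suc_Suc)
  also have "\<dots> = first_passage y j * real (u * (u + 1))"
    unfolding 2 first_passage_def walk_prob_def u_def[symmetric] using pos by (simp add: field_simps)
  finally show ?thesis by (simp add: u_def)
qed

text \<open>
  The numerator and the denominator of the quotient of consecutive values, with \<open>u = y + 2 * j\<close>,
  are \<open>u * (u + 1)\<close> and \<open>(u + 2)\<^sup>2 - y\<^sup>2\<close>. Their difference is linear in \<open>j\<close>, hence changes sign only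
  once.
\<close>

lemma first_passage_ratio_cmp:
  assumes "y > 0"
  shows "int ((y + 2 * j) * (y + 2 * j + 1)) - int (4 * (j + 1) * (y + j + 1)) = int ((y - 1) * (y - 2)) - 6 * (int j + 1)"
proof -
  have "int ((y - 1) * (y - 2)) = (int y - 1) * (int y - 2)"
    using assms by (cases "y = 1") (auto simp: of_nat_diff)
  then show ?thesis by (simp add: algebra_simps)
qed

lemma first_passage_unimodal:
  assumes "y > 0"
  shows "j < (y - 1) * (y - 2) div 6 \<Longrightarrow> first_passage y j \<le> first_passage y (Suc j)"
    and "(y - 1) * (y - 2) div 6 \<le> j \<Longrightarrow> first_passage y (Suc j) \<le> first_passage y j"
proof -
  define q where "q = (y + 2 * j) * (y + 2 * j + 1)"
  define r where "r = 4 * (j + 1) * (y + j + 1)"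
  define M where "M = (y - 1) * (y - 2)"
  have eq: "first_passage y (Suc j) * real r = first_passage y j * real q"
    using first_passage_Suc[OF assms] by (simp add: q_def r_def)
  have cmp: "int q - int r = int M - 6 * (int j + 1)"
    using first_passage_ratio_cmp[OF assms] unfolding q_def r_def M_def .
  have "r > 0" by (simp add: r_def)
  have up: "first_passage y j \<le> first_passage y (Suc j)" if "j < M div 6"
  proof -
    have "6 * (int j + 1) \<le> int M" using that by presburger
    then have "r \<le> q" using cmp by linarith
    then have "first_passage y j * real r \<le> first_passage y (Suc j) * real r"
      unfolding eq by (intro mult_left_mono first_passage_nonneg of_nat_mono)
    then show ?thesis using \<open>r > 0\<close> by simp
  qed
  have down: "first_passage y (Suc j) \<le> first_passage y j" if "M div 6 \<le> j"
  proof -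
    have "int M \<le> 6 * (int j + 1)" using that by presburger
    then have "q \<le> r" using cmp by linarith
    then have "first_passage y (Suc j) * real r \<le> first_passage y j * real r"
      unfolding eq by (intro mult_left_mono first_passage_nonneg of_nat_mono)
    then show ?thesis using \<open>r > 0\<close> by simp
  qed
  show "j < (y - 1) * (y - 2) div 6 \<Longrightarrow> first_passage y j \<le> first_passage y (Suc j)"
    and "(y - 1) * (y - 2) div 6 \<le> j \<Longrightarrow> first_passage y (Suc j) \<le> first_passage y j"
    using up down by (simp_all only: M_def)
qed

section \<open>The discrepancy as a sum of influences\<close>

definition imbalance :: "configuration \<Rightarrow> int \<Rightarrow> nat \<Rightarrow> real" where
  "imbalance c y s = of_int (propp_arrow c y s) * real (propp_chips c y s mod 2)"

text \<open>
  An even number of chips leaves the arrow as it is, an odd number reverses it. In this form the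
  imbalances of a vertex telescope.
\<close>

lemma imbalance_eq:
  "imbalance c y s = (of_int (propp_arrow c y s) - of_int (propp_arrow c y (Suc s))) / 2"
  by (cases "even (propp_chips c y s)") (simp_all add: imbalance_def propp_arrow_Suc mod2_eq_if)

text \<open>
  Both machines obey the same linear recurrence, up to the imbalances of the two neighbours that
  the Propp machine adds in each step. Unrolling the recurrence gives this formula. The range of
  vertices is left open because that of \<open>x\<close> must serve for both neighbours in the induction.
\<close>

lemma discrepancy_eq_sum_influence:
  assumes "valid_config c" "finite Y" "{x - int t..x + int t} \<subseteq> Y"
  shows "real (propp_chips c x t) - expected_chips c x t
    = (\<Sum>y\<in>Y. \<Sum>s<t. imbalance c y s * influence (t - Suc s) (x - y))"
  using assms(3)
proof (induction t arbitrary: x)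
  case 0
  then show ?case by (simp add: expected_chips_0)
next
  case (Suc t)
  have sub: "{x - 1 - int t..x - 1 + int t} \<subseteq> Y" "{x + 1 - int t..x + 1 + int t} \<subseteq> Y"
    by (rule subset_trans[OF _ Suc.prems]; auto)+
  have inY: "x - 1 \<in> Y" "x + 1 \<in> Y" using Suc.prems by auto
  have old: "(\<Sum>s<t. imbalance c y s * influence (Suc t - Suc s) (x - y))
     = ((\<Sum>s<t. imbalance c y s * influence (t - Suc s) (x - 1 - y))
      + (\<Sum>s<t. imbalance c y s * influence (t - Suc s) (x + 1 - y))) / 2" for y
    unfolding sum.distrib[symmetric] sum_divide_distrib
  proof (rule sum.cong[OF refl])
    fix s assume "s \<in> {..<t}"
    then have "Suc t - Suc s = Suc (t - Suc s)" by auto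
    moreover have "x - y - 1 = x - 1 - y" "x - y + 1 = x + 1 - y" by auto
    ultimately show "imbalance c y s * influence (Suc t - Suc s) (x - y)
      = (imbalance c y s * influence (t - Suc s) (x - 1 - y)
        + imbalance c y s * influence (t - Suc s) (x + 1 - y)) / 2"
      by (simp only: influence.simps) (simp add: algebra_simps)
  qed
  have new: "(\<Sum>y\<in>Y. imbalance c y t * influence 0 (x - y)) = (imbalance c (x - 1) t - imbalance c (x + 1) t) / 2"
  proof -
    have "(\<Sum>y\<in>Y. imbalance c y t * influence 0 (x - y))
      = (\<Sum>y\<in>{x - 1, x + 1}. imbalance c y t * influence 0 (x - y))"
      using assms(2) inY by (intro sum.mono_neutral_right) auto
    then show ?thesis by (simp add: field_simps)
  qed
  have "real (propp_chips c x (Suc t)) - expected_chips c x (Suc t)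
    = ((real (propp_chips c (x - 1) t) - expected_chips c (x - 1) t)
      + (real (propp_chips c (x + 1) t) - expected_chips c (x + 1) t)) / 2
      + (imbalance c (x - 1) t - imbalance c (x + 1) t) / 2"
    unfolding propp_chips_Suc[OF assms(1)] expected_chips_Suc imbalance_def
    by (simp add: field_simps)
  then show ?case
    unfolding Suc.IH[OF sub(1)] Suc.IH[OF sub(2)] new[symmetric]
    by (simp only: sum.lessThan_Suc diff_self_eq_0 old sum.distrib sum_divide_distrib[symmetric])
qed

lemma even_config_parity:
  assumes "valid_config c" "even_config c" "odd (x + int t)"
  shows "propp_chips c x t = 0" "expected_chips c x t = 0"
  using assms(3)
proof (induction t arbitrary: x)
  case 0
  case 1 then show ?case using assms(2) by (simp add: even_config_def)
  case 2 then show ?case using assms(2) by (simp add: even_config_def expected_chips_0)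
next
  case (Suc t)
  case 1
  then have "real (propp_chips c x (Suc t)) = 0"
    unfolding propp_chips_Suc[OF assms(1)] using Suc.IH(1)[of "x - 1"] Suc.IH(1)[of "x + 1"] by simp
  then show ?case by simp
  case 2
  then show ?case unfolding expected_chips_Suc using Suc.IH(2)[of "x - 1"] Suc.IH(2)[of "x + 1"] by simp
qed

section \<open>The contribution of one vertex\<close>

text \<open>
  Reversing time turns the sum into an alternating sum over the number \<open>n\<close> of remaining steps.
  The imbalance vanishes for every second \<open>n\<close>, where the influence is zero and would
  spoil unimodality. Hence the influence may be replaced there by any other value, and \<open>W\<close> repeats
  the value of the preceding \<open>n\<close>.
\<close>

lemma vertex_contribution_pos:
  assumes v: "valid_config c" and e: "even_config c" and par: "even (x + int t)" and y: "d > 0"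
    and xy: "\<bar>x - y\<bar> = int d"
  shows "\<bar>\<Sum>s<t. imbalance c y s * influence (t - Suc s) (int d)\<bar> \<le> peak_passage d"
proof -
  define a where "a n = real_of_int (propp_arrow c y (t - n))" for n
  define W where "W n = (if Suc n < d then 0 else first_passage d ((Suc n - d) div 2))" for n
  define p where "p = (d - 1) * (d - 2) div 6"
  define m where "m = d - 1 + 2 * p"
  note unimodal = first_passage_unimodal[OF y, folded p_def]
  have nonneg: "0 \<le> W n" for n by (simp add: W_def first_passage_nonneg)
  define T where "T = (\<Sum>n<t. (a n - a (Suc n)) * W n)"
  have "\<bar>T\<bar> \<le> 2 * W m"
    unfolding T_def
  proof (rule alternating_sum_le_twice_peak)
    show "\<bar>a n\<bar> \<le> 1" for n
      using propp_arrow_valid[OF v, of y "t - n"] by (auto simp: a_def)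
    show "W n \<le> W (Suc n)" if "n < m" for n
    proof (cases "Suc n < d")
      case True
      then show ?thesis using nonneg[of "Suc n"] by (simp add: W_def)
    next
      case False
      define i where "i = Suc n - d"
      have "Suc (Suc n) - d = Suc i" "i < 2 * p" using False that y by (auto simp: i_def m_def)
      moreover have "first_passage d (i div 2) \<le> first_passage d (Suc i div 2)"
        using unimodal(1)[of "i div 2"] \<open>i < 2 * p\<close> by (cases "even i") auto
      ultimately show ?thesis using False by (simp add: W_def i_def)
    qed
    show "W (Suc n) \<le> W n" if "m \<le> n" for n
    proof -
      define i where "i = Suc n - d"
      have i: "\<not> Suc n < d" "Suc (Suc n) - d = Suc i" "2 * p \<le> i" using that y by (auto simp: i_def m_def)
      moreover have "first_passage d (Suc i div 2) \<le> first_passage d (i div 2)"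
        using unimodal(2)[of "i div 2"] \<open>2 * p \<le> i\<close> by (cases "even i") auto
      ultimately show ?thesis by (simp add: W_def i_def)
    qed
  qed (rule nonneg)
  moreover have "W m = peak_passage d"
    using y by (simp add: W_def m_def peak_passage_def p_def)
  moreover have "(\<Sum>s<t. imbalance c y s * influence (t - Suc s) (int d))
    = - T / 2"
  proof -
    have "(\<Sum>s<t. imbalance c y s * influence (t - Suc s) (int d))
      = (\<Sum>n<t. imbalance c y (t - Suc n) * influence (t - Suc (t - Suc n)) (int d))"
      by (rule sum.nat_diff_reindex[symmetric])
    also have "\<dots> = (\<Sum>n<t. - ((a n - a (Suc n)) * W n) / 2)"
    proof (rule sum.cong[OF refl])
      fix n assume "n \<in> {..<t}"
      then have n: "n < t" by simp
      have "t - Suc (t - Suc n) = n" "Suc (t - Suc n) = t - n" using n by auto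
      then have im: "imbalance c y (t - Suc n) = - (a n - a (Suc n)) / 2"
        by (simp add: imbalance_eq a_def)
      have "imbalance c y (t - Suc n) * influence n (int d) = imbalance c y (t - Suc n) * W n"
      proof (cases "odd (y + int (t - Suc n))")
        case True
        then show ?thesis using even_config_parity(1)[OF v e True] by (simp add: imbalance_def)
      next
        case False
        have "even (x - y + int (Suc n))"
          using False par n by (simp add: of_nat_diff) presburger
        then have "even (d + Suc n)" using xy by presburger
        show ?thesis
        proof (cases "Suc n < d")
          case True
          then show ?thesis using influence_eq_0[of n "int d"] by (simp add: W_def)
        next
          case ge: False
          define j where "j = (Suc n - d) div 2"
          have "Suc n = d + 2 * j" using ge \<open>even (d + Suc n)\<close> unfolding j_def by presburger
          then have "n = d + 2 * j - 1" by simp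
          then show ?thesis using influence_eq_first_passage[OF y, of j] ge by (simp add: W_def j_def)
        qed
      qed
      also have "\<dots> = - ((a n - a (Suc n)) * W n) / 2"
        unfolding im by (simp add: algebra_simps)
      finally show "imbalance c y (t - Suc n) * influence (t - Suc (t - Suc n)) (int d)
        = - ((a n - a (Suc n)) * W n) / 2"
        using \<open>t - Suc (t - Suc n) = n\<close> by simp
    qed
    finally show ?thesis by (simp add: T_def sum_divide_distrib sum_negf)
  qed
  ultimately show ?thesis by simp
qed

lemma vertex_contribution:
  assumes "valid_config c" "even_config c" "even (x + int t)"
  shows "\<bar>\<Sum>s<t. imbalance c y s * influence (t - Suc s) (x - y)\<bar> \<le> peak_passage (nat \<bar>x - y\<bar>)"
proof -
  consider "x = y" | "x > y" | "x < y" by linarith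
  then show ?thesis
  proof cases
    case 1
    have "influence n 0 = 0" for n using influence_minus[of n 0] by simp
    then show ?thesis using 1 by (simp add: peak_passage_nonneg)
  next
    case 2
    then show ?thesis using vertex_contribution_pos[OF assms, of "nat \<bar>x - y\<bar>" y] by simp
  next
    case 3
    then have "influence n (x - y) = - influence n (int (nat \<bar>x - y\<bar>))" for n
      using influence_minus[of n "y - x"] by simp
    then show ?thesis using 3 vertex_contribution_pos[OF assms, of "nat \<bar>x - y\<bar>" y]
      by (simp add: sum_negf)
  qed
qed

lemma sum_distance:
  fixes g :: "nat \<Rightarrow> real"
  assumes "g 0 = 0"
  shows "(\<Sum>y\<in>{x - int t..x + int t}. g (nat \<bar>x - y\<bar>)) = 2 * (\<Sum>k\<in>{1..t}. g k)"
proof (induction t)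
  case 0
  then show ?case using assms by simp
next
  case (Suc t)
  have "{x - int (Suc t)..x + int (Suc t)} =
    insert (x - int (Suc t)) (insert (x + int (Suc t)) {x - int t..x + int t})" by auto
  then show ?case using Suc by (simp add: nat_add_distrib)
qed

text \<open>
  If \<open>x + t\<close> is odd, then neither machine has a chip at \<open>x\<close>. Otherwise the contributions of all
  vertices within distance \<open>t\<close> add up.
\<close>

theorem discrepancy_le_sum_peaks:
  assumes "valid_config c" "even_config c"
  shows "\<bar>real (propp_chips c x t) - expected_chips c x t\<bar> \<le> 2 * (\<Sum>k=1..t. peak_passage k)"
proof (cases "even (x + int t)")
  case True
  have "\<bar>real (propp_chips c x t) - expected_chips c x t\<bar>
    \<le> (\<Sum>y\<in>{x - int t..x + int t}. peak_passage (nat \<bar>x - y\<bar>))"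
    unfolding discrepancy_eq_sum_influence[OF assms(1) finite_atLeastAtMost_int order_refl]
    by (rule order_trans[OF sum_abs], rule sum_mono, rule vertex_contribution[OF assms True])
  then show ?thesis by (simp add: sum_distance)
next
  case False
  then show ?thesis using even_config_parity[OF assms False]
    by (simp add: sum_nonneg peak_passage_nonneg)
qed

section \<open>A Gaussian bound for the walk\<close>

text \<open>
  For \<open>a < 1\<close> this says \<open>artanh a \<ge> a\<close> in logarithmic form. It bounds the factors
  \<open>(1 - a) / (1 + a)\<close> by which the binomial coefficients decrease away from the centre.
\<close>

lemma one_minus_le_exp:
  assumes "0 \<le> a"
  shows "(1 - a) \<le> (1 + a) * exp (- 2 * a :: real)"
proof -
  \<comment> \<open>Splitting the exponential between both sides gives a derivative with an evident sign.\<close>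
  define f where "f a = (1 + a) * exp (- a) - (1 - a) * exp (a :: real)" for a
  have "f 0 \<le> f a"
  proof (rule DERIV_nonneg_imp_nondecreasing[OF assms])
    fix b :: real assume "0 \<le> b" "b \<le> a"
    have "(f has_real_derivative b * (exp b - exp (- b))) (at b)"
      unfolding f_def by (auto intro!: derivative_eq_intros simp: algebra_simps)
    moreover have "0 \<le> b * (exp b - exp (- b))" using \<open>0 \<le> b\<close> by simp
    ultimately show "\<exists>y. (f has_real_derivative y) (at b) \<and> 0 \<le> y" by blast
  qed
  then have "(1 - a) * exp a \<le> (1 + a) * exp (- a)" by (simp add: f_def)
  then have "(1 - a) * exp a * exp (- a) \<le> (1 + a) * exp (- a) * exp (- a)" by (rule mult_right_mono) simp
  then show ?thesis by (simp add: mult.assoc exp_add[symmetric])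
qed

lemma walk_prob_0_Suc: "walk_prob 0 (Suc m) * (2 * real m + 2) = walk_prob 0 m * (2 * real m + 1)"
proof -
  have "Suc (Suc (2 * m)) * (Suc (2 * m) choose m) = (Suc (Suc (2 * m)) choose Suc m) * Suc m"
    by (rule Suc_times_binomial_eq)
  moreover have "(Suc (2 * m) - m) * (Suc (2 * m) choose m) = Suc (2 * m) * (2 * m choose m)"
    using binomial_absorb_comp[of "Suc (2 * m)" m] by simp
  moreover have "Suc (2 * m) - m = Suc m" by simp
  ultimately have "(Suc (Suc (2 * m)) choose Suc m) * Suc m = 2 * (Suc (2 * m) * (2 * m choose m))"
    by (metis mult.assoc mult.commute mult_2 mult_Suc_right add_Suc_right add_Suc)
  then have "real (Suc (Suc (2 * m)) choose Suc m) * real (Suc m) = 2 * (real (Suc (2 * m)) * real (2 * m choose m))"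
    by (metis of_nat_mult of_nat_numeral)
  then have "real (Suc (Suc (2 * m)) choose Suc m) * (2 * real m + 2)
      = 4 * (real (2 * m choose m) * (2 * real m + 1))"
    by (simp add: algebra_simps del: binomial_Suc_Suc)
  moreover have "0 + 2 * Suc m = Suc (Suc (2 * m))" by simp
  moreover have "p / (2 * (2 * e)) * r = q / e * s" if "p * r = 4 * (q * s)" for p q r s e :: real
  proof -
    have "p / (2 * (2 * e)) * r = (p * r) / (4 * e)" by simp
    then show ?thesis unfolding that by simp
  qed
  ultimately show ?thesis by (simp only: walk_prob_def power_Suc add_0)
qed

text \<open>
  The product \<open>walk_prob 0 m ^ 2 * (m + c)\<close> tends to \<open>1 / pi\<close> for every \<open>c\<close>, and for large \<open>m\<close> it
  decreases if \<open>c > 1/4\<close>. With \<open>c\<close> close to \<open>1/4\<close> it is already near its limit at \<open>m = 20\<close>, so that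
  a single evaluation gives a good constant.
\<close>

lemma walk_prob_0_le: "m \<ge> 20 \<Longrightarrow> (walk_prob 0 m)\<^sup>2 * (real m + 0.26) \<le> 0.3185"
proof (induction m rule: nat_induct_at_least)
  case base
  show ?case by (simp add: walk_prob_def binomial_fact fact_numeral power2_eq_square)
next
  case (Suc m)
  define w where "w = walk_prob 0 m"
  have eq: "walk_prob 0 (Suc m) = w * (2 * real m + 1) / (2 * real m + 2)"
    using walk_prob_0_Suc[of m] by (simp add: w_def field_simps)
  have "(2 * real m + 1)\<^sup>2 * (real (Suc m) + 0.26) \<le> (2 * real m + 2)\<^sup>2 * (real m + 0.26)"
    using Suc.hyps by (simp add: power2_eq_square algebra_simps)
  then have "((2 * real m + 1) / (2 * real m + 2))\<^sup>2 * (real (Suc m) + 0.26) \<le> real m + 0.26"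
    by (simp add: power_divide field_simps)
  then have "w\<^sup>2 * (((2 * real m + 1) / (2 * real m + 2))\<^sup>2 * (real (Suc m) + 0.26)) \<le> w\<^sup>2 * (real m + 0.26)"
    by (rule mult_left_mono) simp
  moreover have "(walk_prob 0 (Suc m))\<^sup>2 * (real (Suc m) + 0.26)
      = w\<^sup>2 * (((2 * real m + 1) / (2 * real m + 2))\<^sup>2 * (real (Suc m) + 0.26))"
    unfolding eq by (simp only: power_divide power_mult_distrib times_divide_eq_right times_divide_eq_left mult.assoc)
  ultimately show ?case using Suc.IH unfolding w_def by linarith
qed

lemma walk_prob_add_2:
  "walk_prob (y + 2) j * (real y + real j + 2) = walk_prob y (Suc j) * (real j + 1)"
proof -
  define u where "u = y + 2 + 2 * j"
  have 1: "Suc j * (u choose Suc j) = u * ((u - 1) choose j)"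
    using binomial_absorption[of j u] by simp
  have 2: "(u - j) * (u choose j) = u * ((u - 1) choose j)"
    by (rule binomial_absorb_comp)
  have "u - j = y + j + 2" by (simp add: u_def)
  with 1 2 have "(y + j + 2) * (u choose j) = Suc j * (u choose Suc j)" by simp
  then have "real (y + j + 2) * real (u choose j) = real (Suc j) * real (u choose Suc j)"
    by (metis of_nat_mult)
  moreover have "y + 2 + 2 * j = u" "y + 2 * Suc j = u" by (auto simp: u_def)
  ultimately show ?thesis by (simp only: walk_prob_def) (simp add: field_simps)
qed

text \<open>
  Induction on \<open>y\<close> in steps of two, at a fixed number \<open>u\<close> of steps: moving from \<open>y\<close> to \<open>y + 2\<close>
  multiplies the probability by \<open>(1 - a) / (1 + a)\<close> with \<open>a = (y + 1) / (u + 1)\<close>, and the factors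
  \<open>exp (- 2 * a)\<close> multiply to the Gaussian because \<open>(y + 2)\<^sup>2 - y\<^sup>2 = 4 * (y + 1)\<close>. The constant is
  twice that of \<open>walk_prob_0_le\<close>, as \<open>u = 2 * j\<close> for \<open>y = 0\<close>.
\<close>

lemma walk_prob_le_gaussian:
  assumes "y + 2 * j \<ge> 40"
  shows "(walk_prob y j)\<^sup>2 \<le> 0.637 / real (y + 2 * j) * exp (- ((real y)\<^sup>2 / (real (y + 2 * j) + 1)))"
  using assms
proof (induction y arbitrary: j rule: nat_induct2)
  case 0
  then have "(walk_prob 0 j)\<^sup>2 * (real j + 0.26) \<le> 0.3185" by (intro walk_prob_0_le) simp
  moreover have "(walk_prob 0 j)\<^sup>2 * real j \<le> (walk_prob 0 j)\<^sup>2 * (real j + 0.26)"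
    by (rule mult_left_mono) auto
  ultimately have "(walk_prob 0 j)\<^sup>2 * real j \<le> 0.3185" by linarith
  then show ?case using 0 by (simp add: field_simps)
next
  case 1
  define v where "v = 2 * real j + 2"
  \<comment> \<open>A walk is at zero after an even number of steps if it was at \<open>1\<close> or \<open>-1\<close> and turned back.\<close>
  have "(Suc (2 * j) choose Suc j) = (Suc (2 * j) choose j)"
    using binomial_symmetric[of "Suc j" "Suc (2 * j)"] by (simp del: binomial_Suc_Suc)
  then have "(Suc (Suc (2 * j)) choose Suc j) = 2 * (Suc (2 * j) choose j)"
    unfolding binomial_Suc_Suc[of "Suc (2 * j)" j] by linarith
  then have eq: "walk_prob 1 j = walk_prob 0 (Suc j)"
    by (simp add: walk_prob_def del: binomial_Suc_Suc)
  have "(walk_prob 0 (Suc j))\<^sup>2 * (real (Suc j) + 0.26) \<le> 0.3185"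
    using 1 by (intro walk_prob_0_le) simp
  moreover have "(walk_prob 0 (Suc j))\<^sup>2 * real (Suc j) \<le> (walk_prob 0 (Suc j))\<^sup>2 * (real (Suc j) + 0.26)"
    by (rule mult_left_mono) auto
  ultimately have "(walk_prob 0 (Suc j))\<^sup>2 * real (Suc j) \<le> 0.3185" by linarith
  moreover have "(walk_prob 0 (Suc j))\<^sup>2 * v = (walk_prob 0 (Suc j))\<^sup>2 * real (Suc j) * 2"
    by (simp add: v_def algebra_simps)
  moreover have "z * 2 \<le> 0.637" if "z \<le> 0.3185" for z :: real
    using that by simp
  ultimately have "(walk_prob 0 (Suc j))\<^sup>2 * v \<le> 0.637" by metis
  then have "(walk_prob 1 j)\<^sup>2 \<le> 0.637 / v"
    unfolding eq by (simp add: field_simps v_def)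
  also have "\<dots> = 0.637 / (v - 1) * (1 - 1 / v)"
  proof -
    have "v > 1" by (simp add: v_def)
    then have "K / v = K / (v - 1) * (1 - 1 / v)" for K by (simp add: field_simps)
    then show ?thesis .
  qed
  \<comment> \<open>Replacing \<open>v\<close> by \<open>v - 1\<close> in the denominator gains just what the exponential costs.\<close>
  also have "\<dots> \<le> 0.637 / (v - 1) * exp (- (1 / v))"
    using exp_ge_add_one_self[of "- (1 / v)"] by (intro mult_left_mono) (auto simp: v_def)
  finally show ?case by (simp add: v_def add.commute)
next
  case (step y)
  define n where "n = real y + 2 * real j + 3"
  define a where "a = (real y + 1) / n"
  have n: "n > 0" by (simp add: n_def)
  have "walk_prob (y + 2) j * (1 + a) = walk_prob y (Suc j) * (1 - a)"
  proof -
    have "1 + a = 2 / n * (real y + real j + 2)" "1 - a = 2 / n * (real j + 1)"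
      using n by (simp_all add: a_def field_simps) (simp_all add: n_def)
    then show ?thesis using walk_prob_add_2[of y j] by (metis mult.left_commute)
  qed
  also have "\<dots> \<le> walk_prob y (Suc j) * ((1 + a) * exp (- 2 * a))"
    by (intro mult_left_mono one_minus_le_exp) (auto simp: a_def n_def walk_prob_def)
  finally have "walk_prob (y + 2) j * (1 + a) \<le> walk_prob y (Suc j) * exp (- 2 * a) * (1 + a)"
    by (simp only: ac_simps)
  moreover have "0 < 1 + a" using n by (simp add: a_def add_pos_nonneg)
  ultimately have "walk_prob (y + 2) j \<le> walk_prob y (Suc j) * exp (- 2 * a)"
    by (rule mult_right_le_imp_le)
  then have "(walk_prob (y + 2) j)\<^sup>2 \<le> (walk_prob y (Suc j) * exp (- 2 * a))\<^sup>2"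
    by (intro power_mono) (auto simp: walk_prob_def)
  also have "\<dots> = (walk_prob y (Suc j))\<^sup>2 * exp (- 4 * a)"
    by (simp add: power_mult_distrib power2_eq_square exp_add[symmetric])
  also have "\<dots> \<le> 0.637 / real (y + 2 * Suc j) * exp (- ((real y)\<^sup>2 / (real (y + 2 * Suc j) + 1))) * exp (- 4 * a)"
    by (intro mult_right_mono step.IH) (use step.prems in auto)
  also have "\<dots> = 0.637 / real (y + 2 * Suc j) * exp (- ((real y)\<^sup>2 / (real (y + 2 * Suc j) + 1)) + - 4 * a)"
    by (simp only: exp_add mult.assoc)
  also have "real (y + 2 * Suc j) + 1 = n" by (simp add: n_def)
  also have "- ((real y)\<^sup>2 / n) + - 4 * a = - ((real (y + 2))\<^sup>2 / n)"
    using n by (simp add: a_def field_simps power2_eq_square)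
  finally show ?case by (simp add: n_def algebra_simps)
qed

section \<open>The series of the peaks\<close>

lemma exp_3_ge: "exp (3::real) \<ge> 20.06"
proof -
  \<comment> \<open>Close to zero the quadratic Taylor polynomial is precise enough.\<close>
  have "(20.06::real) \<le> (1 + 3/64 + (3/64)\<^sup>2 / 2) ^ 64" by (simp add: power2_eq_square power_divide)
  also have "\<dots> \<le> exp (3/64) ^ 64" by (intro power_mono exp_lower_Taylor_quadratic) auto
  also have "\<dots> = exp 3" by (simp add: exp_of_nat_mult[symmetric])
  finally show ?thesis .
qed

text \<open>
  The function \<open>w * exp (- w)\<close> has its maximum at \<open>w = 1\<close>.
\<close>

lemma cube_exp_le:
  fixes w :: real assumes "w \<ge> 0"
  shows "w ^ 3 * exp (- 3 * w) \<le> exp (- 3)"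
proof -
  have "w \<le> exp (w - 1)" using exp_ge_add_one_self[of "w - 1"] by simp
  then have "w ^ 3 \<le> exp (w - 1) ^ 3" using assms by (intro power_mono)
  also have "\<dots> = exp (- 3) * exp (3 * w)" by (simp add: exp_of_nat_mult[symmetric] exp_add[symmetric])
  finally have "w ^ 3 * exp (- 3 * w) \<le> exp (- 3) * exp (3 * w) * exp (- 3 * w)" by (rule mult_right_mono) simp
  then show ?thesis by (simp add: mult.assoc exp_add[symmetric])
qed

text \<open>
  At the peak, \<open>u = y + 2 * j\<close> is at least about \<open>y\<^sup>2 / 3\<close>, hence large, so that \<open>u\<close> and
  \<open>v = u + 1\<close> are nearly equal. In terms of \<open>w = y\<^sup>2 / (3 * v)\<close> the squared Gaussian bound is a
  multiple of \<open>w ^ 3 * exp (- 3 * w)\<close>, which is maximal for \<open>w = 1\<close>. Squares avoid the roots of \<open>u\<close>.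
\<close>

lemma peak_passage_tail:
  assumes "y \<ge> 25"
  shows "peak_passage y \<le> 0.933 / (real y)\<^sup>2"
proof -
  define j where "j = (y - 1) * (y - 2) div 6"
  define u where "u = y + 2 * j"
  have "(y - 1) * (y - 2) + 3 * y = y * y + 2"
  proof -
    obtain k where "y = k + 2" using assms that[of "y - 2"] by simp
    then show ?thesis by (simp add: algebra_simps)
  qed
  \<comment> \<open>Integer division loses at most 5.\<close>
  moreover have "(y - 1) * (y - 2) \<le> 6 * j + 5" unfolding j_def by linarith
  ultimately have "y * y \<le> 3 * u + 3" by (simp add: u_def)
  moreover have "25 * 25 \<le> y * y" using assms by (intro mult_mono) auto
  ultimately have u: "u \<ge> 208" by linarith
  define Y where "Y = real y"
  define v where "v = real u + 1"
  define w where "w = Y\<^sup>2 / (3 * v)"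
  have Y: "Y > 0" using assms by (simp add: Y_def)
  have v: "v \<ge> 209" using u by (simp add: v_def)
  have peak: "peak_passage y = Y / (v - 1) * walk_prob y j"
    by (simp add: peak_passage_def first_passage_def walk_prob_def Y_def v_def u_def j_def)
  have "(peak_passage y * Y\<^sup>2)\<^sup>2 = Y ^ 6 / (v - 1)\<^sup>2 * (walk_prob y j)\<^sup>2"
    unfolding peak by (simp add: power_mult_distrib power_divide field_simps flip: power_add power_mult)
  also have "\<dots> \<le> Y ^ 6 / (v - 1)\<^sup>2 * (0.637 / (v - 1) * exp (- (Y\<^sup>2 / v)))"
    using walk_prob_le_gaussian[of y j] u
    by (intro mult_left_mono) (auto simp: Y_def v_def u_def)
  also have "\<dots> = 0.637 * 27 * (v / (v - 1)) ^ 3 * (w ^ 3 * exp (- 3 * w))"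
  proof -
    have "Y\<^sup>2 = 3 * v * w" using v by (simp add: w_def)
    moreover have "Y ^ 6 = (Y\<^sup>2) ^ 3" by (simp flip: power_mult)
    ultimately have "Y ^ 6 = 27 * v ^ 3 * w ^ 3" "Y\<^sup>2 / v = 3 * w"
      using v by (simp_all add: power_mult_distrib)
    moreover have "27 * p * q / e\<^sup>2 * (0.637 / e * r) = 0.637 * 27 * (p / e ^ 3) * (q * r)"
      for p q r e :: real by (simp add: power2_eq_square power3_eq_cube)
    ultimately show ?thesis by (simp only: power_divide mult_minus_left)
  qed
  also have "\<dots> \<le> 0.637 * 27 * (209 / 208) ^ 3 * exp (- 3)"
  proof (intro mult_mono mult_left_mono power_mono cube_exp_le)
    show "v / (v - 1) \<le> 209 / 208" using v by (simp add: field_simps)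
  qed (use v in \<open>auto simp: w_def\<close>)
  also have "\<dots> \<le> 0.637 * 27 * (209 / 208) ^ 3 * (1 / 20.06)"
    using exp_3_ge by (intro mult_left_mono) (auto simp: exp_minus field_simps)
  also have "\<dots> \<le> 0.933\<^sup>2" by (simp add: power2_eq_square power3_eq_cube)
  finally have "peak_passage y * Y\<^sup>2 \<le> 0.933" by (rule power2_le_imp_le) simp
  then show ?thesis using Y by (simp add: field_simps Y_def)
qed

text \<open>
  Comparison with a telescoping series, as \<open>1 / (r\<^sup>2 - 1/4) = 1 / (r - 1/2) - 1 / (r + 1/2)\<close>.
\<close>

lemma sum_peak_passage_tail: "(\<Sum>k=25..<25+n. peak_passage k) \<le> 0.933 / 24.5 - 0.933 / (real n + 24.5)"
proof (induction n)
  case (Suc n)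
  define r where "r = real n + 25"
  have r: "r > 1" by (simp add: r_def)
  have "peak_passage (25 + n) \<le> 0.933 / r\<^sup>2"
    using peak_passage_tail[of "25 + n"] by (simp add: r_def add.commute)
  also have "\<dots> \<le> 0.933 / (r\<^sup>2 - 1/4)"
    using one_less_power[OF r, of 2] by (intro divide_left_mono mult_pos_pos) auto
  also have "\<dots> = 0.933 / (r - 1/2) - 0.933 / (r + 1/2)"
  proof -
    have factors: "r\<^sup>2 - 1/4 = (r - 1/2) * (r + 1/2)"
      by (simp add: algebra_simps power2_eq_square)
    have "K / (p * q) = K / p - K / q" if "p > 0" "q > 0" "q = p + 1" for K p q :: real
      using that by (simp add: field_simps)
    then show ?thesis unfolding factors by this (use r in auto)
  qed
  also have "r - 1/2 = real n + 24.5" by (simp add: r_def)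
  also have "r + 1/2 = real (Suc n) + 24.5" by (simp add: r_def)
  finally have "peak_passage (25 + n) \<le> 0.933 / (real n + 24.5) - 0.933 / (real (Suc n) + 24.5)" .
  moreover have "(\<Sum>k=25..<25 + Suc n. peak_passage k)
      = (\<Sum>k=25..<25 + n. peak_passage k) + peak_passage (25 + n)"
    unfolding add_Suc_right by (rule sum.atLeastLessThan_Suc) simp
  ultimately show ?case using Suc by linarith
qed simp

lemma first_passage_numeral:
  "first_passage (numeral y) (numeral k) = first_passage (numeral y) (pred_numeral k) *
    (((numeral y + 2 * real (pred_numeral k)) * (numeral y + 2 * real (pred_numeral k) + 1)) /
     (4 * (real (pred_numeral k) + 1) * (numeral y + real (pred_numeral k) + 1)))"
proof -
  define j where "j = pred_numeral k"
  have divide: "F = G * (q / r)" if "F * r = G * q" "r \<noteq> 0" for F G q r :: real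
    using that by (simp add: field_simps)
  have "first_passage (numeral y) (Suc j) = first_passage (numeral y) j *
      (real ((numeral y + 2 * j) * (numeral y + 2 * j + 1)) /
       real (4 * (j + 1) * (numeral y + j + 1)))"
    by (rule divide[OF first_passage_Suc]) (simp_all only: of_nat_eq_0_iff, auto)
  moreover have "numeral k = Suc j" by (simp add: j_def)
  ultimately show ?thesis
    unfolding j_def[symmetric]
    by (simp only: of_nat_mult of_nat_add of_nat_numeral of_nat_1)
qed

lemma first_passage_0: "y > 0 \<Longrightarrow> first_passage y 0 = 1 / 2 ^ y"
  by (simp add: first_passage_def walk_prob_def)

lemma first_passage_Suc_0: "first_passage y (Suc 0) = real y / 2 ^ (y + 2)"
  by (simp add: first_passage_def walk_prob_def)

text \<open>
  The recurrence in \<open>j\<close> keeps the numbers in this evaluation small, in contrast to the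
  factorials in the binomial coefficients. The true value is about \<open>1.10932\<close>.
\<close>

lemma sum_peak_passage_head: "(\<Sum>k=1..<25. peak_passage k) \<le> 1.10933"
  by (simp add: atLeastLessThan_nat_numeral peak_passage_def first_passage_0 first_passage_Suc_0
      first_passage_numeral)

lemma sum_peak_passage_le: "2 * (\<Sum>k=1..t. peak_passage k) \<le> 2.2949"
proof -
  have "(\<Sum>k=1..t. peak_passage k) \<le> (\<Sum>k=1..<25 + t. peak_passage k)"
    by (rule sum_mono2) (auto simp: peak_passage_nonneg)
  also have "\<dots> = (\<Sum>k=1..<25. peak_passage k) + (\<Sum>k=25..<25 + t. peak_passage k)"
    by (rule sum.atLeastLessThan_concat[symmetric]) auto
  also have "\<dots> \<le> 1.10933 + 0.933 / 24.5"
    using sum_peak_passage_tail[of t]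
    by (intro add_mono sum_peak_passage_head) (rule order_trans, auto)
  finally show ?thesis by simp
qed

section \<open>The discrepancy bound\<close>

theorem theorem3:
  shows "\<exists>c1 :: real. \<bar>c1 - 2.29\<bar> < 0.005 \<and>
    (\<forall>c :: configuration. valid_config c \<longrightarrow> even_config c \<longrightarrow>
      (\<forall>(x :: int) (t :: nat).
        \<bar>real (propp_chips c x t) - expected_chips c x t\<bar> \<le> c1))"
proof (intro exI[of _ "2.2949"] conjI allI impI)
  fix c :: configuration and x :: int and t :: nat
  assume "valid_config c" and "even_config c"
  then show "\<bar>real (propp_chips c x t) - expected_chips c x t\<bar> \<le> 2.2949"
    using discrepancy_le_sum_peaks sum_peak_passage_le order_trans by blast
qed simp

end
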